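(* Consider a stochastic dynamic team $(\mathcal{P}^D)$ with partially nested information structure, in which $\hat y^D_i=g_i(h_i(\zeta),u^D_{\downarrow i})$, and suppose that for all $i\in\mathcal{N}$ and every fixed $u^D_{\downarrow i}$ the function $g_i(\cdot,u^D_{\downarrow i}):h_i(\zeta)\mapsto\hat y^D_i$ is invertible for all realizations of $\zeta$. Let $\underline\gamma^{D*}\in\Gamma^D$ and $\underline\gamma^{S*}\in\Gamma^S$ be related by the policy-dependent static reduction, i.e. $u^i=\gamma^{S*}_i(y^S_i)=\gamma^{D*}_i(y^D_i)$ $P$-a.s. for all $i\in\mathcal{N}$. Then $\underline\gamma^{D*}$ is a globally optimal policy for $(\mathcal{P}^D)$ if and only if $\underline\gamma^{S*}$ is a globally optimal policy for $(\mathcal{P}^S)$.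
   Context: Setting. $\mathcal{N}=\{1,\dots,N\}$; the decision makers DM$^1,\dots,$DM$^N$ act in this order, each once. Action spaces $\mathbb{U}^i\subseteq\mathbb{R}^{n_i}$ and observation spaces are Borel subsets of Euclidean spaces. $\zeta=\{\omega_0,\dots,\omega_N\}$ is the collection of all primitive random variables on $(\Omega,\mathcal{F},P)$, $\omega_0$ taking values in a Borel space $\Omega_0$. The cost is a Borel function $c:\Omega_0\times\prod_i\mathbb{U}^i\to\mathbb{R}_+$, and $J(\underline\gamma)=E[c(\omega_0,u^1,\dots,u^N)]$ when actions are generated by $\underline\gamma$. All policies are deterministic. Dynamic team $(\mathcal{P}^D)$. DM$^i$ has information $I^i_D=\{y^D_i\}$, $y^D_i=\{y^D_{\downarrow i},\hat y^D_i\}$, $\hat y^D_i=g_i(h_i(\zeta),u^D_{\downarrow i})$, with $g_i,h_i$ measurable, $\downarrow i=\{j: \hat y^D_i\text{ is affected by }u^j\}$, $y^D_{\downarrow i}=(y^D_j)_{j\in\downarrow i}$ and $u^D_{\downarrow i}=(u^D_j)_{j\in\downarrow i}$. Thus the information structure is partially nested: whenever the action of DM$^k$, $k<i$, affects the information of DM$^i$, the information of DM$^i$ includes that of DM$^k$. $\Gamma^D$ is the set of policies $\underline\gamma^D=(\gamma^D_1,\dots,\gamma^D_N)$, $\gamma^D_i$ measurable, with $u^D_i=\gamma^D_i(y^D_i)$. Static team $(\mathcal{P}^S)$. Same cost; DM$^i$ has information $I^i_S=\{y^S_i\}$, $y^S_i=\{y^S_{\downarrow i},\hat y^S_i\}$,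 $\hat y^S_i=h_i(\zeta)$; $\Gamma^S$ is the set of policies $\underline\gamma^S$ with $u^S_i=\gamma^S_i(y^S_i)$. Under the invertibility assumption, given the policies of the preceding DMs, there is a bijection between $y^D_i$ and $y^S_i$ (via $h_i(\zeta)=g_i^{-1}(\hat y^D_i,\gamma^D_{\downarrow i}(y^D_{\downarrow i}))$), so each $\underline\gamma^D\in\Gamma^D$ yields $\underline\gamma^S\in\Gamma^S$, and conversely, through $\gamma^S_i(y^S_i)=\gamma^D_i(y^D_i)$ $P$-a.s. for all $i$; this is the policy-dependent static reduction. $\underline\gamma^{D*}$ is globally optimal for $(\mathcal{P}^D)$ if $J(\underline\gamma^{D*})=\inf_{\underline\gamma^D\in\Gamma^D}J(\underline\gamma^D)$, and $\underline\gamma^{S*}$ is globally optimal for $(\mathcal{P}^S)$ if $J(\underline\gamma^{S*})=\inf_{\underline\gamma^S\in\Gamma^S}J(\underline\gamma^S)$. *)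

theory Defs
  imports "HOL-Probability.Probability"
begin

text \<open>
  Vectors of the space of dimension \<open>d\<close> are functions \<open>nat \<Rightarrow> real\<close> that are
  \<open>undefined\<close> outside \<open>{..<d}\<close>; this lets the dimension depend on the decision maker.
\<close>

definition euclid :: "nat \<Rightarrow> (nat \<Rightarrow> real) measure" where
  "euclid d = (\<Pi>\<^sub>M i\<in>{..<d}. (borel :: real measure))"

type_synonym vec = "nat \<Rightarrow> real"

text \<open>A profile assigns a vector (an action or an observation) to each decision maker.\<close>

type_synonym profile = "nat \<Rightarrow> vec"

text \<open>
  A policy vector: \<open>\<gamma> i\<close> is the policy of the \<open>i\<close>-th decision maker, applied to the profile
  of the observation components contained in that decision maker's information.
\<close>

type_synonym policy = "nat \<Rightarrow> profile \<Rightarrow> vec"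

text \<open>
  The primitive random variable \<open>prim k\<close>, for \<open>k = 0, \<dots>, num\<close>, takes values in the Borel
  subset \<open>primS k\<close> of the Polish type \<open>'w\<close>; one type suffices for all \<open>k\<close>, since a finite disjoint
  union of Polish spaces is Polish.  The static observation \<open>h i \<zeta>\<close> lies in the Borel
  set \<open>obsS i\<close> and the dynamic observation \<open>g i (h i \<zeta>) u\<close> in the Borel set \<open>obsD i\<close>.
\<close>

record ('s, 'w) team =
  num :: nat
  pspace :: "'s measure"
  primS :: "nat \<Rightarrow> 'w set"
  prim :: "nat \<Rightarrow> 's \<Rightarrow> 'w"
  actdim :: "nat \<Rightarrow> nat"
  act :: "nat \<Rightarrow> vec set"
  obsdimS :: "nat \<Rightarrow> nat"
  obsS :: "nat \<Rightarrow> vec set"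
  obsdimD :: "nat \<Rightarrow> nat"
  obsD :: "nat \<Rightarrow> vec set"
  h :: "nat \<Rightarrow> (nat \<Rightarrow> 'w) \<Rightarrow> vec"
  g :: "nat \<Rightarrow> vec \<Rightarrow> profile \<Rightarrow> vec"
  down :: "nat \<Rightarrow> nat set"
  cost :: "'w \<Rightarrow> profile \<Rightarrow> real"

definition primM :: "('s, 'w::polish_space) team \<Rightarrow> nat \<Rightarrow> 'w measure" where
  "primM T k = restrict_space borel (primS T k)"

definition zetaM :: "('s, 'w::polish_space) team \<Rightarrow> (nat \<Rightarrow> 'w) measure" where
  "zetaM T = (\<Pi>\<^sub>M k\<in>{0..num T}. primM T k)"

definition zeta :: "('s, 'w) team \<Rightarrow> 's \<Rightarrow> nat \<Rightarrow> 'w" where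
  "zeta T s = (\<lambda>k\<in>{0..num T}. prim T k s)"

definition actM :: "('s, 'w) team \<Rightarrow> nat \<Rightarrow> vec measure" where
  "actM T i = restrict_space (euclid (actdim T i)) (act T i)"

definition obsSM :: "('s, 'w) team \<Rightarrow> nat \<Rightarrow> vec measure" where
  "obsSM T i = restrict_space (euclid (obsdimS T i)) (obsS T i)"

definition obsDM :: "('s, 'w) team \<Rightarrow> nat \<Rightarrow> vec measure" where
  "obsDM T i = restrict_space (euclid (obsdimD T i)) (obsD T i)"

text \<open>
  The observation of \<open>i\<close> is affected by the action of \<open>j\<close>: changing only the action of \<open>j\<close>
  can change the value of the observation, for some realization of the primitive variables.
\<close>

definition affects :: "('s, 'w::polish_space) team \<Rightarrow> nat \<Rightarrow> nat \<Rightarrow> bool" where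
  "affects T j i \<longleftrightarrow>
     (\<exists>z\<in>space (zetaM T). \<exists>u\<in>space (\<Pi>\<^sub>M k\<in>{1..<i}. actM T k). \<exists>u'\<in>space (\<Pi>\<^sub>M k\<in>{1..<i}. actM T k).
        (\<forall>k. k \<noteq> j \<longrightarrow> u k = u' k) \<and>
        g T i (h T i z) (restrict u (down T i)) \<noteq> g T i (h T i z) (restrict u' (down T i)))"

definition dynamic_team :: "('s, 'w::polish_space) team \<Rightarrow> bool" where
  "dynamic_team T \<longleftrightarrow>
     1 \<le> num T \<and>
     prob_space (pspace T) \<and>
     (\<forall>k\<in>{0..num T}. primS T k \<in> sets borel \<and> prim T k \<in> pspace T \<rightarrow>\<^sub>M primM T k) \<and>
     (\<forall>i\<in>{1..num T}.
        act T i \<in> sets (euclid (actdim T i)) \<and>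
        obsS T i \<in> sets (euclid (obsdimS T i)) \<and>
        obsD T i \<in> sets (euclid (obsdimD T i)) \<and>
        down T i = {j\<in>{1..<i}. affects T j i} \<and>
        h T i \<in> zetaM T \<rightarrow>\<^sub>M obsSM T i \<and>
        (\<lambda>(x, u). g T i x u) \<in> obsSM T i \<Otimes>\<^sub>M (\<Pi>\<^sub>M j\<in>down T i. actM T j) \<rightarrow>\<^sub>M obsDM T i) \<and>
     (\<lambda>(w, u). cost T w u) \<in> primM T 0 \<Otimes>\<^sub>M (\<Pi>\<^sub>M i\<in>{1..num T}. actM T i) \<rightarrow>\<^sub>M borel \<and>
     (\<forall>w\<in>primS T 0. \<forall>u\<in>space (\<Pi>\<^sub>M i\<in>{1..num T}. actM T i). 0 \<le> cost T w u)"

text \<open>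
  \<open>info T i\<close> indexes the observation components in the information of \<open>i\<close>.  It unfolds the
  nested collection \<open>y\<^sub>i = {(y\<^sub>j)\<^sub>j, own observation of i}\<close>, with \<open>j\<close> ranging over \<open>down T i\<close>,
  into the family of its components (see \<open>info_unfold\<close>).
\<close>

inductive_set info :: "('s, 'w) team \<Rightarrow> nat \<Rightarrow> nat set" for T :: "('s, 'w) team" and i :: nat where
  own: "i \<in> info T i"
| nested: "j \<in> info T i \<Longrightarrow> k \<in> down T j \<Longrightarrow> k \<in> info T i"

lemma info_trans: "j \<in> info T i \<Longrightarrow> k \<in> info T j \<Longrightarrow> k \<in> info T i"
  by (rotate_tac, induction rule: info.induct) (auto intro: info.intros)

lemma info_unfold: "info T i = insert i (\<Union>j\<in>down T i. info T j)"
proof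
  show "info T i \<subseteq> insert i (\<Union>j\<in>down T i. info T j)"
  proof
    fix k assume "k \<in> info T i"
    then show "k \<in> insert i (\<Union>j\<in>down T i. info T j)"
      by induction (auto intro: info.intros)
  qed
  show "insert i (\<Union>j\<in>down T i. info T j) \<subseteq> info T i"
    using info_trans[OF info.nested[OF info.own]] by (auto intro: info.own)
qed

lemma partially_nested: "k \<in> down T j \<Longrightarrow> j \<in> info T i \<Longrightarrow> info T k \<subseteq> info T i"
  using info_trans[OF info.nested] by blast

text \<open>
  The observation and action profiles of the dynamic team after the first \<open>n\<close> decision makers
  have acted, when the primitive variables take the value \<open>z\<close>.
\<close>

primrec run :: "('s, 'w) team \<Rightarrow> policy \<Rightarrow> (nat \<Rightarrow> 'w) \<Rightarrow> nat \<Rightarrow> profile \<times> profile" where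
  "run T \<gamma> z 0 = (\<lambda>_. undefined, \<lambda>_. undefined)"
| "run T \<gamma> z (Suc n) =
     (let i = Suc n;
          y = (fst (run T \<gamma> z n))(i := g T i (h T i z) (restrict (snd (run T \<gamma> z n)) (down T i)));
          u = (snd (run T \<gamma> z n))(i := \<gamma> i (restrict y (info T i)))
      in (y, u))"

definition obs_D :: "('s, 'w) team \<Rightarrow> policy \<Rightarrow> 's \<Rightarrow> profile" where
  "obs_D T \<gamma> s = fst (run T \<gamma> (zeta T s) (num T))"

definition action_D :: "('s, 'w) team \<Rightarrow> policy \<Rightarrow> 's \<Rightarrow> profile" where
  "action_D T \<gamma> s = snd (run T \<gamma> (zeta T s) (num T))"

definition info_D :: "('s, 'w) team \<Rightarrow> policy \<Rightarrow> nat \<Rightarrow> 's \<Rightarrow> profile" where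
  "info_D T \<gamma> i s = restrict (obs_D T \<gamma> s) (info T i)"

definition info_S :: "('s, 'w) team \<Rightarrow> nat \<Rightarrow> 's \<Rightarrow> profile" where
  "info_S T i s = (\<lambda>k\<in>info T i. h T k (zeta T s))"

definition action_S :: "('s, 'w) team \<Rightarrow> policy \<Rightarrow> 's \<Rightarrow> profile" where
  "action_S T \<gamma> s = (\<lambda>i. \<gamma> i (info_S T i s))"

definition policies_D :: "('s, 'w) team \<Rightarrow> policy set" where
  "policies_D T = {\<gamma>. \<forall>i\<in>{1..num T}. \<gamma> i \<in> (\<Pi>\<^sub>M k\<in>info T i. obsDM T k) \<rightarrow>\<^sub>M actM T i}"

definition policies_S :: "('s, 'w) team \<Rightarrow> policy set" where
  "policies_S T = {\<gamma>. \<forall>i\<in>{1..num T}. \<gamma> i \<in> (\<Pi>\<^sub>M k\<in>info T i. obsSM T k) \<rightarrow>\<^sub>M actM T i}"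

text \<open>The cost is nonnegative, so its expectation is taken in \<open>[0, \<infinity>]\<close> and may be infinite.\<close>

definition expected_cost :: "('s, 'w) team \<Rightarrow> ('s \<Rightarrow> profile) \<Rightarrow> ennreal" where
  "expected_cost T u = (\<integral>\<^sup>+ s. ennreal (cost T (prim T 0 s) (restrict (u s) {1..num T})) \<partial>pspace T)"

definition globally_optimal_D :: "('s, 'w) team \<Rightarrow> policy \<Rightarrow> bool" where
  "globally_optimal_D T \<gamma>' \<longleftrightarrow>
     \<gamma>' \<in> policies_D T \<and>
     expected_cost T (action_D T \<gamma>') = (INF \<gamma>\<in>policies_D T. expected_cost T (action_D T \<gamma>))"

definition globally_optimal_S :: "('s, 'w) team \<Rightarrow> policy \<Rightarrow> bool" where
  "globally_optimal_S T \<gamma>' \<longleftrightarrow>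
     \<gamma>' \<in> policies_S T \<and>
     expected_cost T (action_S T \<gamma>') = (INF \<gamma>\<in>policies_S T. expected_cost T (action_S T \<gamma>))"

definition policy_dependent_reduction :: "('s, 'w) team \<Rightarrow> policy \<Rightarrow> policy \<Rightarrow> bool" where
  "policy_dependent_reduction T \<gamma>D \<gamma>S \<longleftrightarrow>
     (\<forall>i\<in>{1..num T}. AE s in pspace T. \<gamma>S i (info_S T i s) = \<gamma>D i (info_D T \<gamma>D i s))"

text \<open>The recursion solves the closed-loop equations of the dynamic team.\<close>

lemma down_less: "dynamic_team T \<Longrightarrow> i \<in> {1..num T} \<Longrightarrow> down T i \<subseteq> {1..<i}"
  unfolding dynamic_team_def by blast

lemma info_le:
  assumes "dynamic_team T" "i \<in> {1..num T}"
  shows "info T i \<subseteq> {1..i}"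
proof
  fix k assume "k \<in> info T i"
  then show "k \<in> {1..i}"
  proof induction
    case own
    then show ?case using assms(2) by simp
  next
    case (nested j k)
    then show ?case using down_less[OF assms(1), of j] assms(2) by fastforce
  qed
qed

lemma run_stable:
  assumes "i \<le> n"
  shows "fst (run T \<gamma> z n) i = fst (run T \<gamma> z i) i" "snd (run T \<gamma> z n) i = snd (run T \<gamma> z i) i"
  using assms by (induction n rule: dec_induct) (simp_all add: Let_def)

lemma closed_loop:
  assumes "dynamic_team T" "i \<in> {1..num T}"
  shows "obs_D T \<gamma> s i = g T i (h T i (zeta T s)) (restrict (action_D T \<gamma> s) (down T i))"
    and "action_D T \<gamma> s i = \<gamma> i (info_D T \<gamma> i s)"
proof -
  let ?z = "zeta T s"
  obtain n where n: "i = Suc n" using assms(2) by (cases i) auto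
  have "restrict (snd (run T \<gamma> ?z n)) (down T i) = restrict (action_D T \<gamma> s) (down T i)"
  proof (rule restrict_ext)
    fix j assume "j \<in> down T i"
    then have "j \<le> n" "j \<le> num T" using down_less[OF assms] assms(2) n by auto
    then show "snd (run T \<gamma> ?z n) j = action_D T \<gamma> s j"
      by (simp add: action_D_def run_stable[of j n] run_stable[of j "num T"])
  qed
  then show "obs_D T \<gamma> s i = g T i (h T i ?z) (restrict (action_D T \<gamma> s) (down T i))"
    using assms(2) run_stable(1)[of i "num T" T \<gamma> ?z] by (simp add: obs_D_def n Let_def)
  have "restrict (fst (run T \<gamma> ?z i)) (info T i) = info_D T \<gamma> i s"
    unfolding info_D_def
  proof (rule restrict_ext)
    fix j assume "j \<in> info T i"
    then have "j \<le> i" "j \<le> num T" using info_le[OF assms] assms(2) by auto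
    then show "fst (run T \<gamma> ?z i) j = obs_D T \<gamma> s j"
      by (simp add: obs_D_def run_stable[of j i] run_stable[of j "num T"])
  qed
  then show "action_D T \<gamma> s i = \<gamma> i (info_D T \<gamma> i s)"
    using assms(2) run_stable(2)[of i "num T" T \<gamma> ?z] by (simp add: action_D_def n Let_def)
qed

end

theory Submission
  imports Defs
begin

text \<open>
  Both teams realize the same action profiles up to null sets, so their infima agree.  A dynamic
  policy is turned into a static one by simulating the run from the static observations.
  Conversely, a static policy fixes the actions, and by invertibility the dynamic information of
  a decision maker then determines the static one pointwise, hence the action.  The inverse need
  not be measurable, since \<open>h i\<close> may have a non-Borel image, but almost everywhere it is:
  a Borel subset of a graph in a product of Polish spaces is exhausted up to a null set by
  compact sets, whose projections are Borel.
\<close>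

section \<open>Almost everywhere Borel factorization on Polish spaces\<close>

text \<open>The image of a Borel set under a Borel map is in general only analytic. Pushing
  \<open>\<mu>\<close> forward to the graph of \<open>F\<close> turns the image into a projection.
  Inner regularity replaces the graph by countably many compact sets, and projections of compact
  sets are compact.\<close>

lemma AE_image_contains_borel:
  fixes \<mu> :: "'z::polish_space measure" and F :: "'z \<Rightarrow> 'y::polish_space"
  assumes "finite_measure \<mu>" and sets_\<mu>: "sets \<mu> = sets borel" and E: "E \<in> sets borel"
    and F: "F \<in> restrict_space borel E \<rightarrow>\<^sub>M borel"
  obtains B where "B \<in> sets borel" "B \<subseteq> F ` E" "AE z in \<mu>. z \<in> E \<longrightarrow> F z \<in> B"
proof -
  interpret finite_measure \<mu> by fact
  \<comment> \<open>A total Borel extension of \<open>F\<close>; its value outside \<open>E\<close>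
    does not enter \<open>G\<close>, which only has points over \<open>E\<close>.\<close>
  define F' where "F' z = (if z \<in> E then F z else undefined)" for z
  have F'[measurable]: "F' \<in> borel \<rightarrow>\<^sub>M borel"
    unfolding F'_def using F E by (subst (asm) measurable_restrict_space_iff) auto
  \<comment> \<open>The graph of \<open>F\<close> over \<open>E\<close>, written as a zero set of
    the distance so that it is Borel.\<close>
  define G where "G = {p. fst p \<in> E \<and> dist (F' (fst p)) (snd p) = 0}"
  have "{p \<in> space (borel :: ('z \<times> 'y) measure). fst p \<in> E \<and> dist (F' (fst p)) (snd p) = 0} \<in> sets borel"
    using E unfolding borel_prod[symmetric] by measurable
  then have G: "G \<in> sets borel" by (simp add: G_def)
  define graph where "graph z = (z, F' z)" for z
  have graph: "graph \<in> \<mu> \<rightarrow>\<^sub>M borel"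
    unfolding measurable_cong_sets[OF sets_\<mu> refl] borel_prod[symmetric] graph_def by measurable
  define \<nu> where "\<nu> = distr \<mu> borel graph"
  interpret \<nu>: finite_measure \<nu>
    unfolding \<nu>_def using graph by (rule finite_measure_distr)
  have compact_sets: "K \<in> sets \<nu>" if "compact K" for K
    using that by (simp add: \<nu>_def borel_closed compact_imp_closed)
  \<comment> \<open>Inner regularity of the finite Borel measure \<open>\<nu>\<close> on the Polish
    product.\<close>
  have "\<exists>K. K \<subseteq> G \<and> compact K \<and> emeasure \<nu> G < emeasure \<nu> K + ennreal (1 / Suc n)" for n
  proof -
    have "emeasure \<nu> G = (SUP K \<in> {K. K \<subseteq> G \<and> compact K}. emeasure \<nu> K)"
      using G by (intro inner_regular) (auto simp: \<nu>_def \<nu>.emeasure_finite[unfolded \<nu>_def])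
    moreover have "\<exists>K\<in>{K. K \<subseteq> G \<and> compact K}. (SUP K \<in> {K. K \<subseteq> G \<and> compact K}. emeasure \<nu> K)
        < emeasure \<nu> K + ennreal (1 / Suc n)"
      by (rule SUP_approx_ennreal) (use calculation \<nu>.emeasure_finite[of G] in \<open>auto simp: less_top\<close>)
    ultimately show ?thesis by auto
  qed
  then obtain K where K: "\<And>n. K n \<subseteq> G" "\<And>n. compact (K n)"
    and approx: "\<And>n. emeasure \<nu> G < emeasure \<nu> (K n) + ennreal (1 / Suc n)"
    by metis
  define U where "U = (\<Union>n. K n)"
  have U: "U \<in> sets \<nu>" "U \<subseteq> G" using K compact_sets by (auto simp: U_def)
  have "emeasure \<nu> G \<le> emeasure \<nu> U"
  proof (rule ennreal_le_epsilon)
    fix e :: real assume "0 < e"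
    then obtain n where n: "1 / Suc n < e" using nat_approx_posE by blast
    have "emeasure \<nu> G \<le> emeasure \<nu> (K n) + ennreal (1 / Suc n)" using approx[of n] by simp
    also have "\<dots> \<le> emeasure \<nu> U + ennreal e"
      using n U by (intro add_mono emeasure_mono ennreal_leI) (auto simp: U_def)
    finally show "emeasure \<nu> G \<le> emeasure \<nu> U + ennreal e" .
  qed
  then have "emeasure \<nu> (G - U) = 0"
    using U G \<nu>.emeasure_finite by (subst emeasure_Diff) (auto simp: \<nu>_def diff_eq_0_iff_ennreal less_top)
  moreover have "G - U \<in> sets \<nu>" using G U by (simp add: \<nu>_def)
  ultimately have "AE p in \<nu>. p \<notin> G - U"
    by (intro AE_not_in) (auto simp: null_sets_def)
  then have "AE z in \<mu>. graph z \<notin> G - U"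
    unfolding \<nu>_def by (rule AE_distrD[OF graph])
  then have "AE z in \<mu>. z \<in> E \<longrightarrow> F z \<in> snd ` U"
    by eventually_elim (force simp: graph_def G_def F'_def intro!: image_eqI)
  moreover have "snd ` U \<subseteq> F ` E"
  proof safe
    fix z y assume "(z, y) \<in> U"
    then have "(z, y) \<in> G" using U(2) by blast
    then show "snd (z, y) \<in> F ` E" by (auto simp: G_def F'_def)
  qed
  \<comment> \<open>Here compactness pays off: \<open>U\<close> is a countable union of compact
    sets, so its projection is one too and hence Borel.\<close>
  moreover have "snd ` U \<in> sets borel"
  proof -
    have "compact (snd ` K n)" for n
      using K(2) by (intro compact_continuous_image continuous_intros)
    then have "snd ` K n \<in> sets borel" for n
      by (intro borel_closed compact_imp_closed)
    then show ?thesis unfolding U_def image_UN by blast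
  qed
  ultimately show ?thesis using that by blast
qed

text \<open>Since \<open>F\<close> determines \<open>H\<close> on \<open>S\<close>, membership of
  \<open>F z\<close> in the image of a sublevel set of \<open>H\<close> decides whether
  \<open>H z\<close> lies below the level. With Borel subsets \<open>B q\<close> in place of these
  images for rational levels \<open>q\<close>, the value \<open>H z\<close> is recovered as an
  infimum of levels.\<close>

lemma AE_factor_real:
  fixes \<mu> :: "'z::polish_space measure" and F :: "'z \<Rightarrow> 'y::polish_space" and H :: "'z \<Rightarrow> real"
  assumes "finite_measure \<mu>" and sets_\<mu>: "sets \<mu> = sets borel"
    and S: "S \<in> sets borel" "AE z in \<mu>. z \<in> S"
    and F: "F \<in> restrict_space borel S \<rightarrow>\<^sub>M borel"
    and H: "H \<in> restrict_space borel S \<rightarrow>\<^sub>M borel"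
    and determined: "\<And>z z'. z \<in> S \<Longrightarrow> z' \<in> S \<Longrightarrow> F z = F z' \<Longrightarrow> H z = H z'"
  obtains \<psi> where "\<psi> \<in> borel_measurable borel" "AE z in \<mu>. \<psi> (F z) = H z"
proof -
  define E where "E q = {z \<in> S. H z < real_of_rat q}" for q
  have E: "E q \<in> sets borel" for q
  proof -
    have "{z \<in> space (restrict_space borel S). H z < real_of_rat q} \<in> sets (restrict_space borel S)"
      using H by measurable
    then show ?thesis using S(1) by (auto simp: E_def space_restrict_space sets_restrict_space_iff)
  qed
  have "\<exists>B. B \<in> sets borel \<and> B \<subseteq> F ` E q \<and> (AE z in \<mu>. z \<in> E q \<longrightarrow> F z \<in> B)" for q
  proof -
    have "F \<in> restrict_space (restrict_space borel S) (E q) \<rightarrow>\<^sub>M borel"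
      using F by (rule measurable_restrict_space1)
    moreover have "restrict_space (restrict_space borel S) (E q) = restrict_space borel (E q)"
      using E[of q] S(1) by (subst restrict_restrict_space) (auto simp: E_def intro!: arg_cong[where f="restrict_space borel"])
    ultimately show ?thesis
      using AE_image_contains_borel[OF assms(1) sets_\<mu> E[of q], of F] by metis
  qed
  then obtain B where B[measurable]: "\<And>q. B q \<in> sets borel" and BF: "\<And>q. B q \<subseteq> F ` E q"
    and AE_B: "\<And>q. AE z in \<mu>. z \<in> E q \<longrightarrow> F z \<in> B q"
    by metis
  \<comment> \<open>The value \<infinity> removes the levels \<open>q\<close> with \<open>y\<close>
    outside \<open>B q\<close>. Where the infimum is infinite, \<open>real_of_ereal\<close> returns
    0; this does not matter, as the infimum is the finite number \<open>H z\<close> at almost every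
    \<open>F z\<close>.\<close>
  define \<psi> where "\<psi> y = real_of_ereal (INF q. if y \<in> B q then ereal (real_of_rat q) else \<infinity>)" for y
  have "\<psi> \<in> borel_measurable borel"
    unfolding \<psi>_def by measurable
  \<comment> \<open>One null set serves all levels because the rationals are countable.\<close>
  moreover have "AE z in \<mu>. \<forall>q. z \<in> E q \<longrightarrow> F z \<in> B q"
    using AE_B by (subst AE_all_countable) auto
  then have "AE z in \<mu>. \<psi> (F z) = H z"
    using S(2)
  proof eventually_elim
    fix z assume z: "\<forall>q. z \<in> E q \<longrightarrow> F z \<in> B q" "z \<in> S"
    \<comment> \<open>The forward direction uses that \<open>B q\<close> lies in the image and that
      \<open>F\<close> determines \<open>H\<close>; the backward direction is where the null set is
      excluded.\<close>
    have iff: "F z \<in> B q \<longleftrightarrow> H z < real_of_rat q" for q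
    proof
      assume "F z \<in> B q"
      then obtain z' where "z' \<in> E q" "F z = F z'" using BF by blast
      then show "H z < real_of_rat q" using determined[of z z'] z(2) by (auto simp: E_def)
    qed (use z in \<open>auto simp: E_def\<close>)
    have "(INF q. if F z \<in> B q then ereal (real_of_rat q) else \<infinity>) = ereal (H z)"
    proof (rule INF_eqI)
      fix y assume y: "\<And>q. q \<in> UNIV \<Longrightarrow> y \<le> (if F z \<in> B q then ereal (real_of_rat q) else \<infinity>)"
      show "y \<le> ereal (H z)"
      proof (rule ereal_le_real)
        fix x assume "ereal (H z) \<le> ereal x"
        have "y \<le> ereal x + ereal e" if "0 < e" for e
        proof -
          have "H z < x + e" using that \<open>ereal (H z) \<le> ereal x\<close> by simp
          then obtain q where "H z < real_of_rat q" "real_of_rat q < x + e"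
            using of_rat_dense by blast
          then show ?thesis using y[of q] by (auto simp: iff intro: order_trans)
        qed
        then show "y \<le> ereal x" using ereal_le_epsilon2 by blast
      qed
    qed (auto simp: iff)
    then show "\<psi> (F z) = H z" by (simp add: \<psi>_def)
  qed
  ultimately show ?thesis using that by blast
qed

text \<open>Countability of the index type is used twice: the exceptional null sets of the
  coordinates combine, and coordinatewise Borel maps are Borel into the function space.\<close>

lemma AE_factor:
  fixes \<mu> :: "'z::polish_space measure" and F :: "'z \<Rightarrow> 'y::polish_space"
    and H :: "'z \<Rightarrow> 'i::countable \<Rightarrow> real"
  assumes "finite_measure \<mu>" "sets \<mu> = sets borel"
    and "S \<in> sets borel" "AE z in \<mu>. z \<in> S"
    and "F \<in> restrict_space borel S \<rightarrow>\<^sub>M borel"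
    and "H \<in> restrict_space borel S \<rightarrow>\<^sub>M borel"
    and "\<And>z z'. z \<in> S \<Longrightarrow> z' \<in> S \<Longrightarrow> F z = F z' \<Longrightarrow> H z = H z'"
  obtains \<psi> where "\<psi> \<in> borel_measurable borel" "AE z in \<mu>. \<psi> (F z) = H z"
proof -
  have "\<exists>\<psi>. \<psi> \<in> borel_measurable borel \<and> (AE z in \<mu>. \<psi> (F z) = H z i)" for i
  proof -
    have "(\<lambda>z. H z i) \<in> borel_measurable (restrict_space borel S)"
      using assms(6) by (rule measurable_product_then_coordinatewise)
    moreover have "H z i = H z' i" if "z \<in> S" "z' \<in> S" "F z = F z'" for z z'
      using assms(7)[OF that] by simp
    ultimately show ?thesis
      using AE_factor_real[OF assms(1-5), of "\<lambda>z. H z i"] by blast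
  qed
  then obtain \<psi> where \<psi>: "\<And>i. \<psi> i \<in> borel_measurable borel" "\<And>i. AE z in \<mu>. \<psi> i (F z) = H z i"
    by metis
  show ?thesis
  proof
    show "(\<lambda>y i. \<psi> i y) \<in> borel_measurable borel"
      using \<psi>(1) by (intro measurable_coordinatewise_then_product)
    have "AE z in \<mu>. \<forall>i. \<psi> i (F z) = H z i"
      using \<psi>(2) by (subst AE_all_countable) auto
    then show "AE z in \<mu>. (\<lambda>i. \<psi> i (F z)) = H z" by eventually_elim auto
  qed
qed

section \<open>Team spaces inside Polish function spaces\<close>

text \<open>Lets elements of the products over \<open>I\<close>, which are extensional functions, be
  regarded as points of the topological space of all functions. Coordinates outside \<open>I\<close>
  are constantly \<open>undefined\<close>, hence measurable.\<close>

lemma measurable_PiM_borel_id: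
  fixes M :: "'i::countable \<Rightarrow> 'a::second_countable_topology measure"
  assumes "\<And>i. i \<in> I \<Longrightarrow> (\<lambda>x. x) \<in> M i \<rightarrow>\<^sub>M borel"
  shows "(\<lambda>x. x) \<in> PiM I M \<rightarrow>\<^sub>M borel"
proof (rule measurable_coordinatewise_then_product)
  fix i
  show "(\<lambda>x. x i) \<in> PiM I M \<rightarrow>\<^sub>M borel"
  proof (cases "i \<in> I")
    case True
    then show ?thesis
      by (intro measurable_compose[OF measurable_component_singleton] assms)
  next
    case False
    then have "x i = undefined" if "x \<in> space (PiM I M)" for x
      using that by (auto simp: space_PiM PiE_def extensional_def)
    then have "(\<lambda>x. x i) \<in> PiM I M \<rightarrow>\<^sub>M borel \<longleftrightarrow> (\<lambda>x. undefined) \<in> PiM I M \<rightarrow>\<^sub>M (borel :: 'a measure)"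
      by (rule measurable_cong)
    then show ?thesis by simp
  qed
qed

text \<open>An extensional product is a countable intersection of cylinders; outside
  \<open>I\<close> the factor is the singleton of \<open>undefined\<close>, closed in a T1
  space.\<close>

lemma PiE_borel:
  fixes A :: "'i::countable \<Rightarrow> 'a::t1_space set"
  assumes "\<And>i. i \<in> I \<Longrightarrow> A i \<in> sets borel"
  shows "PiE I A \<in> sets borel"
proof -
  define B where "B i = (if i \<in> I then A i else {undefined})" for i
  have "(\<lambda>x :: 'i \<Rightarrow> 'a. x i) -` B i \<in> sets borel" for i
    using measurable_sets[OF measurable_product_coordinates, of "B i"] assms
    by (auto simp: B_def)
  then have "(\<Inter>i. (\<lambda>x. x i) -` B i) \<in> sets borel" by blast
  also have "(\<Inter>i. (\<lambda>x. x i) -` B i) = PiE I A"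
    by (auto simp: B_def PiE_def extensional_def split: if_splits)
  finally show ?thesis .
qed

lemma measurable_euclid_id: "(\<lambda>x. x) \<in> euclid d \<rightarrow>\<^sub>M borel"
  unfolding euclid_def by (rule measurable_PiM_borel_id) auto

lemma measurable_obsDM_id: "(\<lambda>x. x) \<in> obsDM T i \<rightarrow>\<^sub>M borel"
  unfolding obsDM_def by (rule measurable_restrict_space1[OF measurable_euclid_id])

lemma measurable_actM_id: "(\<lambda>x. x) \<in> actM T i \<rightarrow>\<^sub>M borel"
  unfolding actM_def by (rule measurable_restrict_space1[OF measurable_euclid_id])

lemma measurable_primM_id: "(\<lambda>x. x) \<in> primM T i \<rightarrow>\<^sub>M borel"
  unfolding primM_def by (rule measurable_restrict_space1) auto

lemma measurable_zetaM_id: "(\<lambda>x. x) \<in> zetaM T \<rightarrow>\<^sub>M borel"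
  unfolding zetaM_def by (rule measurable_PiM_borel_id[OF measurable_primM_id])

lemma space_primM: "space (primM T k) = primS T k"
  by (simp add: primM_def space_restrict_space)

lemma space_zetaM_borel: "dynamic_team T \<Longrightarrow> space (zetaM T) \<in> sets borel"
  unfolding zetaM_def space_PiM space_primM
  by (intro PiE_borel) (auto simp: dynamic_team_def)

text \<open>Together with \<open>space_zetaM_borel\<close>, this turns measurable maps on
  \<open>zetaM T\<close> into Borel maps on a Borel subset of a Polish space, the setting of
  \<open>AE_factor\<close>.\<close>

lemma measurable_id_zetaM: "(\<lambda>x. x) \<in> restrict_space borel (space (zetaM T)) \<rightarrow>\<^sub>M zetaM T"
proof -
  have "(\<lambda>z. z k) \<in> restrict_space borel (space (zetaM T)) \<rightarrow>\<^sub>M primM T k" if "k \<in> {0..num T}" for k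
    unfolding primM_def using that
    by (intro measurable_restrict_space2 measurable_restrict_space1)
       (auto simp: zetaM_def space_PiM space_restrict_space space_primM)
  then show ?thesis
    unfolding zetaM_def by (rule measurable_PiM_single') (auto simp: space_restrict_space space_PiM)
qed

lemma measurable_zeta: "dynamic_team T \<Longrightarrow> zeta T \<in> pspace T \<rightarrow>\<^sub>M zetaM T"
  unfolding zeta_def[abs_def] zetaM_def
  by (intro measurable_restrict) (auto simp: dynamic_team_def)

lemma zeta_space: "dynamic_team T \<Longrightarrow> s \<in> space (pspace T) \<Longrightarrow> zeta T s \<in> space (zetaM T)"
  using measurable_space[OF measurable_zeta] .

section \<open>Measurability of the observation maps and nesting of the index sets\<close>

lemma measurable_h:
  "dynamic_team T \<Longrightarrow> k \<in> {1..num T} \<Longrightarrow> h T k \<in> zetaM T \<rightarrow>\<^sub>M obsSM T k"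
  by (simp add: dynamic_team_def)

lemma measurable_g:
  assumes "dynamic_team T" "k \<in> {1..num T}"
    and "f \<in> N \<rightarrow>\<^sub>M obsSM T k"
    and "\<And>j. j \<in> down T k \<Longrightarrow> (\<lambda>x. v x j) \<in> N \<rightarrow>\<^sub>M actM T j"
  shows "(\<lambda>x. g T k (f x) (restrict (v x) (down T k))) \<in> N \<rightarrow>\<^sub>M obsDM T k"
proof -
  have "(\<lambda>(x, u). g T k x u) \<in> obsSM T k \<Otimes>\<^sub>M (\<Pi>\<^sub>M j\<in>down T k. actM T j) \<rightarrow>\<^sub>M obsDM T k"
    using assms(1,2) unfolding dynamic_team_def by blast
  moreover have "(\<lambda>x. (f x, restrict (v x) (down T k))) \<in> N \<rightarrow>\<^sub>M obsSM T k \<Otimes>\<^sub>M (\<Pi>\<^sub>M j\<in>down T k. actM T j)"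
    using assms(3,4) by (intro measurable_Pair measurable_restrict) auto
  ultimately show ?thesis
    by (auto dest: measurable_compose)
qed

lemma info_num:
  "dynamic_team T \<Longrightarrow> i \<in> {1..num T} \<Longrightarrow> k \<in> info T i \<Longrightarrow> k \<in> {1..num T}"
  using info_le by fastforce

lemma down_info_less:
  assumes "dynamic_team T" "k \<in> {1..num T}" "j \<in> down T k"
  shows "j \<in> {1..num T}" "j < k" "info T j \<subseteq> info T k"
  using down_less[OF assms(1,2)] assms(2,3) partially_nested[OF assms(3) info.own] by auto

section \<open>From dynamic policies to static policies\<close>

text \<open>\<open>run\<close> with the values \<open>h i \<zeta>\<close> of the static observations abstracted to a variable \<open>x\<close>.\<close>

primrec sim :: "('s, 'w) team \<Rightarrow> policy \<Rightarrow> profile \<Rightarrow> nat \<Rightarrow> profile \<times> profile" where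
  "sim T \<gamma> x 0 = (\<lambda>_. undefined, \<lambda>_. undefined)"
| "sim T \<gamma> x (Suc n) =
     (let i = Suc n;
          y = (fst (sim T \<gamma> x n))(i := g T i (x i) (restrict (snd (sim T \<gamma> x n)) (down T i)));
          u = (snd (sim T \<gamma> x n))(i := \<gamma> i (restrict y (info T i)))
      in (y, u))"

text \<open>Entry \<open>i\<close> is read right after stage \<open>i\<close>; by
  \<open>sim_stable\<close> later stages leave it unchanged, so no final stage has to be
  named.\<close>

definition sim_obs :: "('s, 'w) team \<Rightarrow> policy \<Rightarrow> profile \<Rightarrow> profile" where
  "sim_obs T \<gamma> x i = fst (sim T \<gamma> x i) i"

definition sim_act :: "('s, 'w) team \<Rightarrow> policy \<Rightarrow> profile \<Rightarrow> profile" where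
  "sim_act T \<gamma> x i = snd (sim T \<gamma> x i) i"

lemma run_eq_sim: "run T \<gamma> z n = sim T \<gamma> (\<lambda>i. h T i z) n"
  by (induction n) (simp_all add: Let_def)

lemma sim_stable:
  assumes "i \<le> n"
  shows "fst (sim T \<gamma> x n) i = sim_obs T \<gamma> x i" "snd (sim T \<gamma> x n) i = sim_act T \<gamma> x i"
  using assms by (induction n rule: dec_induct) (simp_all add: Let_def sim_obs_def sim_act_def)

lemma sim_closed_loop:
  assumes "dynamic_team T" "i \<in> {1..num T}"
  shows "sim_obs T \<gamma> x i = g T i (x i) (restrict (sim_act T \<gamma> x) (down T i))"
    and "sim_act T \<gamma> x i = \<gamma> i (restrict (sim_obs T \<gamma> x) (info T i))"
proof -
  obtain n where n: "i = Suc n" using assms(2) by (cases i) auto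
  have "restrict (snd (sim T \<gamma> x n)) (down T i) = restrict (sim_act T \<gamma> x) (down T i)"
    using down_less[OF assms] n by (intro restrict_ext sim_stable) auto
  then show "sim_obs T \<gamma> x i = g T i (x i) (restrict (sim_act T \<gamma> x) (down T i))"
    by (simp add: sim_obs_def n Let_def)
  have "restrict (fst (sim T \<gamma> x i)) (info T i) = restrict (sim_obs T \<gamma> x) (info T i)"
    using info_le[OF assms] by (intro restrict_ext sim_stable) auto
  then show "sim_act T \<gamma> x i = \<gamma> i (restrict (sim_obs T \<gamma> x) (info T i))"
    by (simp add: sim_act_def n Let_def)
qed

lemma action_D_sim:
  "i \<in> {1..num T} \<Longrightarrow> action_D T \<gamma> s i = sim_act T \<gamma> (\<lambda>k. h T k (zeta T s)) i"
  by (simp add: action_D_def run_eq_sim sim_stable)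

text \<open>By nestedness \<open>info T i\<close> is closed under passing to \<open>down\<close>, so
  simulating its members never reads \<open>x\<close> outside \<open>info T i\<close>. This makes
  the simulated action a function of the static information of \<open>i\<close>.\<close>

lemma sim_cong:
  assumes T: "dynamic_team T" and i: "i \<in> {1..num T}"
    and eq: "\<And>k. k \<in> info T i \<Longrightarrow> x k = x' k"
  shows "k \<in> info T i \<Longrightarrow> sim_obs T \<gamma> x k = sim_obs T \<gamma> x' k \<and> sim_act T \<gamma> x k = sim_act T \<gamma> x' k"
proof (induction k rule: less_induct)
  case (less k)
  have k: "k \<in> {1..num T}" using info_num[OF T i less.prems] .
  have down: "sim_act T \<gamma> x j = sim_act T \<gamma> x' j" if "j \<in> down T k" for j
    using less.IH[of j] down_info_less(2)[OF T k that] info.nested[OF less.prems that] by blast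
  \<comment> \<open>The own observation comes first: \<open>info T k\<close> contains
    \<open>k\<close> itself, which the induction hypothesis does not cover.\<close>
  have obs: "sim_obs T \<gamma> x k = sim_obs T \<gamma> x' k"
    using eq[OF less.prems] down by (simp add: sim_closed_loop(1)[OF T k] cong: restrict_cong)
  have "sim_obs T \<gamma> x j = sim_obs T \<gamma> x' j" if "j \<in> info T k" for j
  proof (cases "j = k")
    case False
    then have "j < k" using that info_le[OF T k] by force
    then show ?thesis using less.IH info_trans[OF less.prems that] by blast
  qed (simp add: obs)
  then have "restrict (sim_obs T \<gamma> x) (info T k) = restrict (sim_obs T \<gamma> x') (info T k)"
    by (rule restrict_ext)
  then show ?case
    using obs by (simp add: sim_closed_loop(2)[OF T k])
qed

text \<open>The domain stays the product over the information of the fixed \<open>i\<close> while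
  \<open>k\<close> runs through its members, so that the maps obtained for earlier members compose
  with \<open>g\<close> and with the policy of \<open>k\<close>.\<close>

lemma sim_measurable:
  assumes T: "dynamic_team T" and i: "i \<in> {1..num T}" and \<gamma>: "\<gamma> \<in> policies_D T"
  shows "k \<in> info T i \<Longrightarrow>
    (\<lambda>x. sim_obs T \<gamma> x k) \<in> (\<Pi>\<^sub>M k\<in>info T i. obsSM T k) \<rightarrow>\<^sub>M obsDM T k \<and>
    (\<lambda>x. sim_act T \<gamma> x k) \<in> (\<Pi>\<^sub>M k\<in>info T i. obsSM T k) \<rightarrow>\<^sub>M actM T k"
proof (induction k rule: less_induct)
  case (less k)
  let ?N = "\<Pi>\<^sub>M k\<in>info T i. obsSM T k"
  have k: "k \<in> {1..num T}" using info_num[OF T i less.prems] .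
  have obs: "(\<lambda>x. sim_obs T \<gamma> x k) \<in> ?N \<rightarrow>\<^sub>M obsDM T k"
    unfolding sim_closed_loop(1)[OF T k]
  proof (rule measurable_g[OF T k])
    show "(\<lambda>x. x k) \<in> ?N \<rightarrow>\<^sub>M obsSM T k"
      using less.prems by (rule measurable_component_singleton)
    show "(\<lambda>x. sim_act T \<gamma> x j) \<in> ?N \<rightarrow>\<^sub>M actM T j" if "j \<in> down T k" for j
      using less.IH[of j] down_info_less(2)[OF T k that] info.nested[OF less.prems that] by blast
  qed
  have "(\<lambda>x. sim_obs T \<gamma> x j) \<in> ?N \<rightarrow>\<^sub>M obsDM T j" if "j \<in> info T k" for j
  proof (cases "j = k")
    case False
    then have "j < k" using that info_le[OF T k] by force
    then show ?thesis using less.IH info_trans[OF less.prems that] by blast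
  qed (use obs in simp)
  then have "(\<lambda>x. restrict (sim_obs T \<gamma> x) (info T k)) \<in> ?N \<rightarrow>\<^sub>M (\<Pi>\<^sub>M k\<in>info T k. obsDM T k)"
    by (rule measurable_restrict)
  moreover have "\<gamma> k \<in> (\<Pi>\<^sub>M k\<in>info T k. obsDM T k) \<rightarrow>\<^sub>M actM T k"
    using \<gamma> k by (simp add: policies_D_def)
  ultimately have "(\<lambda>x. sim_act T \<gamma> x k) \<in> ?N \<rightarrow>\<^sub>M actM T k"
    unfolding sim_closed_loop(2)[OF T k] by (rule measurable_compose)
  with obs show ?case by blast
qed

text \<open>Decision maker \<open>i\<close> replays the dynamic run of all members of its
  information and then takes its own simulated action.\<close>

lemma static_policy_exists:
  assumes T: "dynamic_team T" and \<gamma>: "\<gamma> \<in> policies_D T"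
  obtains \<gamma>' where "\<gamma>' \<in> policies_S T"
    "\<forall>s. \<forall>i\<in>{1..num T}. action_S T \<gamma>' s i = action_D T \<gamma> s i"
proof
  let ?\<gamma>' = "\<lambda>i x. sim_act T \<gamma> x i"
  show "?\<gamma>' \<in> policies_S T"
    using sim_measurable[OF T _ \<gamma> info.own] by (auto simp: policies_S_def)
  have "action_S T ?\<gamma>' s i = action_D T \<gamma> s i" if i: "i \<in> {1..num T}" for s i
    unfolding action_D_sim[OF i] action_S_def
    \<comment> \<open>The two simulations differ only in that one input is cut down to
      \<open>info T i\<close>.\<close>
    by (rule sim_cong[OF T i _ info.own, THEN conjunct2]) (simp add: info_S_def)
  then show "\<forall>s. \<forall>i\<in>{1..num T}. action_S T ?\<gamma>' s i = action_D T \<gamma> s i" by blast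
qed

section \<open>From static policies to dynamic policies\<close>

definition static_act :: "('s, 'w) team \<Rightarrow> policy \<Rightarrow> (nat \<Rightarrow> 'w) \<Rightarrow> profile" where
  "static_act T \<gamma> z i = \<gamma> i (\<lambda>k\<in>info T i. h T k z)"

text \<open>The dynamic observations that arise when the actions fed into \<open>g\<close> are those
  of the static policy.\<close>

definition static_obs :: "('s, 'w) team \<Rightarrow> policy \<Rightarrow> (nat \<Rightarrow> 'w) \<Rightarrow> profile" where
  "static_obs T \<gamma> z i = g T i (h T i z) (restrict (static_act T \<gamma> z) (down T i))"

lemma static_act_measurable:
  assumes "dynamic_team T" "i \<in> {1..num T}" "\<gamma> \<in> policies_S T"
  shows "(\<lambda>z. static_act T \<gamma> z i) \<in> zetaM T \<rightarrow>\<^sub>M actM T i"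
proof -
  have "(\<lambda>z. \<lambda>k\<in>info T i. h T k z) \<in> zetaM T \<rightarrow>\<^sub>M (\<Pi>\<^sub>M k\<in>info T i. obsSM T k)"
    using measurable_h[OF assms(1) info_num[OF assms(1,2)]] by (rule measurable_restrict)
  moreover have "\<gamma> i \<in> (\<Pi>\<^sub>M k\<in>info T i. obsSM T k) \<rightarrow>\<^sub>M actM T i"
    using assms by (simp add: policies_S_def)
  ultimately show ?thesis unfolding static_act_def by (rule measurable_compose)
qed

lemma static_obs_measurable:
  assumes T: "dynamic_team T" and i: "i \<in> {1..num T}" and \<gamma>: "\<gamma> \<in> policies_S T"
  shows "(\<lambda>z. static_obs T \<gamma> z i) \<in> zetaM T \<rightarrow>\<^sub>M obsDM T i"
  unfolding static_obs_def
  using measurable_h[OF T i] static_act_measurable[OF T down_info_less(1)[OF T i] \<gamma>]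
  by (rule measurable_g[OF T i])

text \<open>The static observations are recovered in the order of play: those already recovered fix
  the actions that enter \<open>g\<close> for \<open>k\<close>, and with these actions fixed
  \<open>g\<close> is injective in the value of \<open>h T k\<close>.\<close>

lemma static_obs_determines:
  assumes T: "dynamic_team T" and i: "i \<in> {1..num T}" and \<gamma>: "\<gamma> \<in> policies_S T"
    and inj: "\<forall>i\<in>{1..num T}. \<forall>u\<in>space (\<Pi>\<^sub>M j\<in>down T i. actM T j).
           inj_on (\<lambda>x. g T i x u) (h T i ` space (zetaM T))"
    and z: "z \<in> space (zetaM T)" "z' \<in> space (zetaM T)"
    and eq: "\<And>k. k \<in> info T i \<Longrightarrow> static_obs T \<gamma> z k = static_obs T \<gamma> z' k"
  shows "k \<in> info T i \<Longrightarrow> h T k z = h T k z'"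
proof (induction k rule: less_induct)
  case (less k)
  have k: "k \<in> {1..num T}" using info_num[OF T i less.prems] .
  have "static_act T \<gamma> z j = static_act T \<gamma> z' j" if "j \<in> down T k" for j
  proof -
    note j = down_info_less[OF T k that]
    have "h T l z = h T l z'" if "l \<in> info T j" for l
      using less.IH[of l] info_le[OF T j(1)] that j info_trans[OF less.prems, of l] by fastforce
    then show ?thesis
      unfolding static_act_def by (metis (mono_tags, lifting) restrict_ext)
  qed
  then have act: "restrict (static_act T \<gamma> z') (down T k) = restrict (static_act T \<gamma> z) (down T k)"
    by (metis (mono_tags, lifting) restrict_ext)
  have "restrict (static_act T \<gamma> z) (down T k) \<in> space (\<Pi>\<^sub>M j\<in>down T k. actM T j)"
    using measurable_space[OF static_act_measurable[OF T down_info_less(1)[OF T k] \<gamma>] z(1)]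
    by (auto simp: space_PiM)
  then have "inj_on (\<lambda>x. g T k x (restrict (static_act T \<gamma> z) (down T k))) (h T k ` space (zetaM T))"
    using inj k by blast
  moreover have "g T k (h T k z) (restrict (static_act T \<gamma> z) (down T k)) =
      g T k (h T k z') (restrict (static_act T \<gamma> z) (down T k))"
    using eq[OF less.prems] by (simp add: static_obs_def act)
  ultimately show ?case
    using z by (auto dest: inj_onD)
qed

text \<open>By \<open>static_obs_determines\<close> the static action of \<open>i\<close> is a
  function of the dynamic information, and \<open>AE_factor\<close> supplies a Borel version of this
  function. The agreement is therefore only almost sure.\<close>

lemma dynamic_policy_exists:
  assumes T: "dynamic_team T" and \<gamma>: "\<gamma> \<in> policies_S T"
    and inj: "\<forall>i\<in>{1..num T}. \<forall>u\<in>space (\<Pi>\<^sub>M j\<in>down T i. actM T j).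
           inj_on (\<lambda>x. g T i x u) (h T i ` space (zetaM T))"
  obtains \<gamma>' where "\<gamma>' \<in> policies_D T"
    "AE s in pspace T. \<forall>i\<in>{1..num T}. action_D T \<gamma>' s i = action_S T \<gamma> s i"
proof -
  interpret prob_space "pspace T" using T by (simp add: dynamic_team_def)
  let ?Z = "space (zetaM T)"
  obtain z0 where z0: "z0 \<in> ?Z" using zeta_space[OF T] not_empty by blast
  have zeta: "zeta T \<in> pspace T \<rightarrow>\<^sub>M borel"
    using measurable_compose[OF measurable_zeta[OF T] measurable_zetaM_id] .
  \<comment> \<open>The law of the primitive variables, viewed as a Borel measure on the Polish
    space of all functions.\<close>
  define \<mu> where "\<mu> = distr (pspace T) borel (zeta T)"
  have \<mu>: "finite_measure \<mu>" "sets \<mu> = sets borel"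
    unfolding \<mu>_def using zeta by (auto intro: finite_measure_distr)
  have AE_Z: "AE z in \<mu>. z \<in> ?Z"
    unfolding \<mu>_def using space_zetaM_borel[OF T] zeta_space[OF T]
    by (subst AE_distr_iff[OF zeta]) auto
  define Y where "Y i z = restrict (static_obs T \<gamma> z) (info T i)" for i z
  have "\<exists>\<phi>. \<phi> \<in> (\<Pi>\<^sub>M k\<in>info T i. obsDM T k) \<rightarrow>\<^sub>M actM T i \<and> (AE z in \<mu>. \<phi> (Y i z) = static_act T \<gamma> z i)"
    if i: "i \<in> {1..num T}" for i
  proof -
    let ?O = "\<Pi>\<^sub>M k\<in>info T i. obsDM T k"
    note act = static_act_measurable[OF T i \<gamma>]
    have "Y i \<in> zetaM T \<rightarrow>\<^sub>M ?O"
      unfolding Y_def using static_obs_measurable[OF T info_num[OF T i] \<gamma>] by (rule measurable_restrict)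
    then have Y: "Y i \<in> restrict_space borel ?Z \<rightarrow>\<^sub>M borel"
      by (intro measurable_compose[OF measurable_compose[OF measurable_id_zetaM]
            measurable_PiM_borel_id[OF measurable_obsDM_id]])
    have U: "(\<lambda>z. static_act T \<gamma> z i) \<in> restrict_space borel ?Z \<rightarrow>\<^sub>M borel"
      using measurable_compose[OF measurable_compose[OF measurable_id_zetaM act] measurable_actM_id] .
    have "static_act T \<gamma> z i = static_act T \<gamma> z' i" if z: "z \<in> ?Z" "z' \<in> ?Z" and eq: "Y i z = Y i z'" for z z'
    proof -
      have "static_obs T \<gamma> z k = static_obs T \<gamma> z' k" if "k \<in> info T i" for k
        using fun_cong[OF eq, of k] that by (simp add: Y_def)
      then have "h T k z = h T k z'" if "k \<in> info T i" for k
        using static_obs_determines[OF T i \<gamma> inj z] that by blast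
      then show ?thesis
        unfolding static_act_def by (metis (mono_tags, lifting) restrict_ext)
    qed
    then obtain \<psi> where \<psi>: "\<psi> \<in> borel_measurable borel"
      and AE_\<psi>: "AE z in \<mu>. \<psi> (Y i z) = static_act T \<gamma> z i"
      using AE_factor[OF \<mu> space_zetaM_borel[OF T] AE_Z Y U] by blast
    have A: "act T i \<in> sets (euclid (actdim T i))" using T i by (simp add: dynamic_team_def)
    have space_act: "space (actM T i) \<subseteq> act T i" by (auto simp: actM_def space_restrict_space)
    \<comment> \<open>The factor \<open>\<psi>\<close> need not take admissible values off the
      essential range. Restricting makes its value a vector of the right dimension, and the fixed
      action \<open>a\<close>, taken at the sample point \<open>z0\<close>, replaces values outside
      the action set.\<close>
    define v where "v y = restrict (\<psi> y) {..<actdim T i}" for y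
    define a where "a = static_act T \<gamma> z0 i"
    define \<phi> where "\<phi> y = (if v y \<in> act T i then v y else a)" for y
    have a: "a \<in> space (actM T i)" unfolding a_def using measurable_space[OF act z0] .
    have \<psi>': "\<psi> \<in> ?O \<rightarrow>\<^sub>M borel"
      using measurable_compose[OF measurable_PiM_borel_id[OF measurable_obsDM_id] \<psi>] .
    have v: "v \<in> ?O \<rightarrow>\<^sub>M euclid (actdim T i)"
      unfolding v_def euclid_def
      by (intro measurable_restrict measurable_product_then_coordinatewise[OF \<psi>'])
    have "\<phi> \<in> ?O \<rightarrow>\<^sub>M euclid (actdim T i)"
      unfolding \<phi>_def
    proof (rule measurable_If[OF v])
      show "(\<lambda>y. a) \<in> ?O \<rightarrow>\<^sub>M euclid (actdim T i)"
        using a by (simp add: actM_def space_restrict_space)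
      have "v -` act T i \<inter> space ?O \<in> sets ?O" using measurable_sets[OF v A] .
      also have "v -` act T i \<inter> space ?O = {y \<in> space ?O. v y \<in> act T i}" by auto
      finally show "{y \<in> space ?O. v y \<in> act T i} \<in> sets ?O" .
    qed
    then have "\<phi> \<in> ?O \<rightarrow>\<^sub>M actM T i"
      unfolding actM_def using a space_act by (intro measurable_restrict_space2) (auto simp: \<phi>_def)
    moreover have "AE z in \<mu>. \<phi> (Y i z) = static_act T \<gamma> z i"
      using AE_\<psi> AE_Z
    proof eventually_elim
      fix z assume \<psi>z: "\<psi> (Y i z) = static_act T \<gamma> z i" and z: "z \<in> ?Z"
      have u: "static_act T \<gamma> z i \<in> space (actM T i)" using measurable_space[OF act z] .
      then have "static_act T \<gamma> z i \<in> extensional {..<actdim T i}"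
        by (auto simp: actM_def euclid_def space_restrict_space space_PiM PiE_def)
      then have "v (Y i z) = static_act T \<gamma> z i"
        by (simp add: v_def \<psi>z extensional_restrict)
      then show "\<phi> (Y i z) = static_act T \<gamma> z i"
        using u space_act by (auto simp: \<phi>_def)
    qed
    ultimately show ?thesis by blast
  qed
  then obtain \<gamma>' where \<gamma>': "\<And>i. i \<in> {1..num T} \<Longrightarrow> \<gamma>' i \<in> (\<Pi>\<^sub>M k\<in>info T i. obsDM T k) \<rightarrow>\<^sub>M actM T i"
    and AE_\<gamma>': "\<And>i. i \<in> {1..num T} \<Longrightarrow> AE z in \<mu>. \<gamma>' i (Y i z) = static_act T \<gamma> z i"
    using bchoice[of "{1..num T}" "\<lambda>i \<phi>. \<phi> \<in> (\<Pi>\<^sub>M k\<in>info T i. obsDM T k) \<rightarrow>\<^sub>M actM T i \<and>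
      (AE z in \<mu>. \<phi> (Y i z) = static_act T \<gamma> z i)"] by blast
  have "AE z in \<mu>. \<forall>i\<in>{1..num T}. \<gamma>' i (Y i z) = static_act T \<gamma> z i"
    using AE_\<gamma>' by (intro AE_finite_allI) auto
  then have "AE s in pspace T. \<forall>i\<in>{1..num T}. \<gamma>' i (Y i (zeta T s)) = static_act T \<gamma> (zeta T s) i"
    unfolding \<mu>_def by (rule AE_distrD[OF zeta])
  then have "AE s in pspace T. \<forall>i\<in>{1..num T}. action_D T \<gamma>' s i = action_S T \<gamma> s i"
  proof eventually_elim
    fix s assume s: "\<forall>i\<in>{1..num T}. \<gamma>' i (Y i (zeta T s)) = static_act T \<gamma> (zeta T s) i"
    let ?z = "zeta T s"
    \<comment> \<open>Outside the null set the closed loop reproduces the static trajectory: equal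
      earlier actions give equal observations, hence the information \<open>Y i\<close>, at which
      \<open>\<gamma>'\<close> returns the static action.\<close>
    have "obs_D T \<gamma>' s i = static_obs T \<gamma> ?z i \<and> action_D T \<gamma>' s i = static_act T \<gamma> ?z i"
      if "i \<in> {1..num T}" for i
      using that
    proof (induction i rule: less_induct)
      case (less i)
      note i = less.prems
      have "action_D T \<gamma>' s j = static_act T \<gamma> ?z j" if "j \<in> down T i" for j
        using less.IH down_info_less(1,2)[OF T i that] by blast
      then have "restrict (action_D T \<gamma>' s) (down T i) = restrict (static_act T \<gamma> ?z) (down T i)"
        by (rule restrict_ext)
      then have obs: "obs_D T \<gamma>' s i = static_obs T \<gamma> ?z i"
        unfolding static_obs_def closed_loop(1)[OF T i] by simp
      have "obs_D T \<gamma>' s j = static_obs T \<gamma> ?z j" if "j \<in> info T i" for j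
      proof (cases "j = i")
        case False
        then have "j < i" using that info_le[OF T i] by force
        then show ?thesis using less.IH info_num[OF T i that] by blast
      qed (simp add: obs)
      then have "info_D T \<gamma>' i s = Y i ?z"
        unfolding info_D_def Y_def by (rule restrict_ext)
      then show ?case
        using obs s i closed_loop(2)[OF T i, of \<gamma>' s] by simp
    qed
    then show "\<forall>i\<in>{1..num T}. action_D T \<gamma>' s i = action_S T \<gamma> s i"
      by (simp add: action_S_def static_act_def info_S_def)
  qed
  moreover have "\<gamma>' \<in> policies_D T"
    using \<gamma>' by (simp add: policies_D_def)
  ultimately show ?thesis using that by blast
qed

section \<open>Comparison of costs and of optimal values\<close>

lemma expected_cost_cong_AE:
  assumes "AE s in pspace T. \<forall>i\<in>{1..num T}. u s i = v s i"
  shows "expected_cost T u = expected_cost T v"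
  unfolding expected_cost_def
proof (rule nn_integral_cong_AE)
  show "AE s in pspace T. ennreal (cost T (prim T 0 s) (restrict (u s) {1..num T})) =
      ennreal (cost T (prim T 0 s) (restrict (v s) {1..num T}))"
    using assms
  proof eventually_elim
    fix s assume "\<forall>i\<in>{1..num T}. u s i = v s i"
    then have "restrict (u s) {1..num T} = restrict (v s) {1..num T}" by (intro restrict_ext) blast
    then show "ennreal (cost T (prim T 0 s) (restrict (u s) {1..num T})) =
      ennreal (cost T (prim T 0 s) (restrict (v s) {1..num T}))" by simp
  qed
qed

theorem theorem4p1:
  fixes T :: "('s, 'w::polish_space) team" and \<gamma>D \<gamma>S :: policy
  assumes "dynamic_team T"
    and "\<forall>i\<in>{1..num T}. \<forall>u\<in>space (\<Pi>\<^sub>M j\<in>down T i. actM T j).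
           inj_on (\<lambda>x. g T i x u) (h T i ` space (zetaM T))"
    and "\<gamma>D \<in> policies_D T" and "\<gamma>S \<in> policies_S T"
    and "policy_dependent_reduction T \<gamma>D \<gamma>S"
  shows "globally_optimal_D T \<gamma>D \<longleftrightarrow> globally_optimal_S T \<gamma>S"
proof -
  \<comment> \<open>In closed loop the reduction relation says precisely that the two policies
    generate the same actions almost surely.\<close>
  have "AE s in pspace T. action_D T \<gamma>D s i = action_S T \<gamma>S s i" if "i \<in> {1..num T}" for i
  proof -
    have "AE s in pspace T. \<gamma>S i (info_S T i s) = \<gamma>D i (info_D T \<gamma>D i s)"
      using assms(5) that by (simp add: policy_dependent_reduction_def)
    then show ?thesis
      by eventually_elim (simp add: closed_loop(2)[OF assms(1) that] action_S_def)
  qed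
  then have "AE s in pspace T. \<forall>i\<in>{1..num T}. action_D T \<gamma>D s i = action_S T \<gamma>S s i"
    by (intro AE_finite_allI) auto
  then have cost: "expected_cost T (action_D T \<gamma>D) = expected_cost T (action_S T \<gamma>S)"
    by (rule expected_cost_cong_AE)
  \<comment> \<open>Every cost realized in one team is realized in the other, so each infimum is
    bounded by the other.\<close>
  have "(INF \<gamma>\<in>policies_D T. expected_cost T (action_D T \<gamma>)) =
      (INF \<gamma>\<in>policies_S T. expected_cost T (action_S T \<gamma>))"
  proof (intro antisym INF_mono)
    fix \<gamma> assume "\<gamma> \<in> policies_S T"
    from assms(1) this assms(2) obtain \<gamma>' where "\<gamma>' \<in> policies_D T"
      and "AE s in pspace T. \<forall>i\<in>{1..num T}. action_D T \<gamma>' s i = action_S T \<gamma> s i"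
      by (rule dynamic_policy_exists)
    then show "\<exists>\<gamma>'\<in>policies_D T. expected_cost T (action_D T \<gamma>') \<le> expected_cost T (action_S T \<gamma>)"
      by (intro bexI[of _ \<gamma>'] eq_refl expected_cost_cong_AE)
  next
    fix \<gamma> assume "\<gamma> \<in> policies_D T"
    with assms(1) obtain \<gamma>' where "\<gamma>' \<in> policies_S T"
      and "\<forall>s. \<forall>i\<in>{1..num T}. action_S T \<gamma>' s i = action_D T \<gamma> s i"
      by (rule static_policy_exists)
    then show "\<exists>\<gamma>'\<in>policies_S T. expected_cost T (action_S T \<gamma>') \<le> expected_cost T (action_D T \<gamma>)"
      by (intro bexI[of _ \<gamma>'] eq_refl expected_cost_cong_AE AE_I2) (auto dest: spec)
  qed
  then show ?thesis
    using assms(3,4) cost by (simp add: globally_optimal_D_def globally_optimal_S_def)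
qed

end
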